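(* Let $a,b,c,J$ be algebraically independent indeterminates, and let $(\tau_n)_{n\in\mathbb{Z}}$ be the sequence in the field $\mathbb{Q}(a,b,c,J)$ generated, in both directions, by the recurrence $$\tau_{n+3}\tau_n=\tau_{n+2}^2+\tau_{n+1}^2+J$$ from the initial data $\tau_0=a$, $\tau_1=b$, $\tau_2=c$. Then: (i) The quantity $$N_n=\frac{\tau_{n+2}^2+\tau_{n+1}^2+\tau_n^2+J}{\tau_{n+2}\tau_{n+1}\tau_n}$$ is an invariant of the recurrence: for all $n$, $N_n=N_0=N$, where $$N=\frac{a^2+b^2+c^2+J}{abc}.$$ (ii) The sequence $(\tau_n)$ coincides with the sequence generated from the same initial data $\tau_0=a$, $\tau_1=b$, $\tau_2=c$ by the recurrence $$\tau_{n+3}=N\,\tau_{n+2}\tau_{n+1}-\tau_n .$$ (iii) All $\tau_n$ lie in the ring $\mathbb{Z}[a,b,c,N]$, which is a subring of the ring of Laurent polynomials $\mathbb{Z}[a^{\pm1},b^{\pm1},c^{\pm1},J]$.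
   Context: The recurrence can be solved uniquely for $\tau_{n+3}$ in terms of $\tau_n,\tau_{n+1},\tau_{n+2}$ and for $\tau_n$ in terms of $\tau_{n+1},\tau_{n+2},\tau_{n+3}$, whenever the term divided by is nonzero; for indeterminate initial data no iterate vanishes identically. Here $\mathbb{Z}[a,b,c,N]$ denotes the subring of $\mathbb{Q}(a,b,c,J)$ generated over $\mathbb{Z}$ by $a,b,c$ and the element $N=(a^2+b^2+c^2+J)/(abc)$. *)

theory Defs
  imports "HOL-Computational_Algebra.Computational_Algebra"
begin

text \<open>The field \<open>\<rat>(a,b,c,J)\<close> is the fraction field of \<open>\<rat>[a][b][c][J]\<close>; the innermost
  polynomial variable is \<open>a\<close>, the outermost one is \<open>J\<close>.\<close>

type_synonym ratfun = "rat poly poly poly poly fract"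

definition ind_a :: ratfun where "ind_a = to_fract [:[:[:[:0, 1:]:]:]:]"
definition ind_b :: ratfun where "ind_b = to_fract [:[:[:0, 1:]:]:]"
definition ind_c :: ratfun where "ind_c = to_fract [:[:0, 1:]:]"
definition ind_J :: ratfun where "ind_J = to_fract [:0, 1:]"

definition init_data :: "(int \<Rightarrow> ratfun) \<Rightarrow> bool" where
  "init_data \<tau> \<longleftrightarrow> \<tau> 0 = ind_a \<and> \<tau> 1 = ind_b \<and> \<tau> 2 = ind_c"

definition quadratic_rec :: "(int \<Rightarrow> ratfun) \<Rightarrow> bool" where
  "quadratic_rec \<tau> \<longleftrightarrow>
     (\<forall>n. \<tau> (n + 3) * \<tau> n = (\<tau> (n + 2))\<^sup>2 + (\<tau> (n + 1))\<^sup>2 + ind_J)"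

definition inv_quot :: "(int \<Rightarrow> ratfun) \<Rightarrow> int \<Rightarrow> ratfun" where
  "inv_quot \<tau> n =
     ((\<tau> (n + 2))\<^sup>2 + (\<tau> (n + 1))\<^sup>2 + (\<tau> n)\<^sup>2 + ind_J) / (\<tau> (n + 2) * \<tau> (n + 1) * \<tau> n)"

definition elt_N :: ratfun where
  "elt_N = (ind_a\<^sup>2 + ind_b\<^sup>2 + ind_c\<^sup>2 + ind_J) / (ind_a * ind_b * ind_c)"

definition N_rec :: "(int \<Rightarrow> ratfun) \<Rightarrow> bool" where
  "N_rec \<sigma> \<longleftrightarrow> (\<forall>n. \<sigma> (n + 3) = elt_N * \<sigma> (n + 2) * \<sigma> (n + 1) - \<sigma> n)"

definition is_subring :: "'k::field set \<Rightarrow> bool" where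
  "is_subring R \<longleftrightarrow> 1 \<in> R \<and> (\<forall>x\<in>R. \<forall>y\<in>R. x - y \<in> R \<and> x * y \<in> R)"

definition Z_adjoin :: "'k::field set \<Rightarrow> 'k set" where
  "Z_adjoin S = is_subring hull S"

lemma is_subring_Z_adjoin: "is_subring (Z_adjoin S)"
  unfolding Z_adjoin_def by (rule hull_in) (auto simp: is_subring_def)

definition ring_abcN :: "ratfun set" where
  "ring_abcN = Z_adjoin {ind_a, ind_b, ind_c, elt_N}"

text \<open>As \<open>a, b, c, J\<close> are algebraically independent, the ring
  \<open>\<int>[a\<^sup>\<plusminus>\<^sup>1, b\<^sup>\<plusminus>\<^sup>1, c\<^sup>\<plusminus>\<^sup>1, J]\<close> of Laurent polynomials is the subring of \<open>\<rat>(a,b,c,J)\<close>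
  generated by the following elements.\<close>

definition laurent_ring :: "ratfun set" where
  "laurent_ring = Z_adjoin
     {ind_a, inverse ind_a, ind_b, inverse ind_b, ind_c, inverse ind_c, ind_J}"

end

theory Submission
  imports Defs
begin

text \<open>The recurrence with \<open>N\<close> is the better behaved of the two: it involves no division and
  can be run in both directions from any three values, so it has exactly one solution
  \<open>\<sigma>\<close> through \<open>a, b, c\<close>, and all \<open>\<sigma> n\<close> lie in every ring that contains \<open>a, b, c, N\<close>.
  The cubic \<open>x\<^sup>2 + y\<^sup>2 + z\<^sup>2 + J - N x y z\<close> does not change along \<open>\<sigma>\<close>: with \<open>y, z\<close> fixed
  it is a monic quadratic in \<open>x\<close> whose roots have the sum \<open>N y z\<close>, so it takes the same value
  at \<open>x\<close> and at \<open>N y z - x\<close>, and one step of the recurrence exchanges these two numbers.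
  The element \<open>N\<close> is chosen such that the cubic vanishes at \<open>(a, b, c)\<close>; hence it
  vanishes along all of \<open>\<sigma>\<close> (lemma \<open>markov_cubic_vanishes\<close>), and \<open>\<sigma> n\<close>, \<open>\<sigma> (n + 3)\<close> are
  the two roots of the quadratic. Vieta's formula for their product is the quadratic
  recurrence (lemma \<open>N_rec_imp_quadratic_rec\<close>), and solving the cubic equation for \<open>N\<close> shows
  that \<open>N\<^sub>n\<close> is constant.

  What remains is that the quadratic recurrence has no other solution through \<open>a, b, c\<close>, and
  for this it is enough that such solutions never vanish. The field \<open>\<rat>(a,b,c,J)\<close> carries an
  ordering for which all four indeterminates are positive. Since \<open>\<tau> (n + 3) \<tau> n\<close> is a sum of
  squares plus \<open>J\<close>, it is positive, so positivity spreads from the initial data to all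
  \<open>\<tau> n\<close> in both directions (lemma \<open>quadratic_rec_pos\<close>).

  Finally, the denominator of \<open>N\<close> is a monomial in \<open>a, b, c\<close>, so that \<open>N\<close> is a Laurent
  polynomial.\<close>

section \<open>Two-sided sequences with a window of three\<close>

lemma int_window_induct:
  fixes P :: "int \<Rightarrow> bool"
  assumes init: "P 0" "P 1" "P 2"
    and up: "\<And>n. P n \<Longrightarrow> P (n + 1) \<Longrightarrow> P (n + 2) \<Longrightarrow> P (n + 3)"
    and down: "\<And>n. P (n + 1) \<Longrightarrow> P (n + 2) \<Longrightarrow> P (n + 3) \<Longrightarrow> P n"
  shows "P n"
proof -
  have "P n \<and> P (n + 1) \<and> P (n + 2)"
  proof (induction n rule: int_induct [where k = 0])
    case base
    show ?case using init by simp
  next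
    case (step1 i)
    then show ?case using up [of i] by (simp add: add.assoc)
  next
    case (step2 i)
    then show ?case using down [of "i - 1"] by (simp add: algebra_simps)
  qed
  then show ?thesis by blast
qed

fun markov_fwd :: "'k::comm_ring_1 \<Rightarrow> 'k \<Rightarrow> 'k \<Rightarrow> 'k \<Rightarrow> nat \<Rightarrow> 'k" where
  "markov_fwd N x y z 0 = x"
| "markov_fwd N x y z (Suc 0) = y"
| "markov_fwd N x y z (Suc (Suc 0)) = z"
| "markov_fwd N x y z (Suc (Suc (Suc n))) =
     N * markov_fwd N x y z (Suc (Suc n)) * markov_fwd N x y z (Suc n) - markov_fwd N x y z n"

text \<open>The recurrence is invariant under the reflection \<open>n \<mapsto> 2 - n\<close>, so the part of the
  sequence to the left of the initial data is the forward sequence started from \<open>z, y, x\<close>.\<close>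

lemma markov_sequence_exists:
  fixes N :: "'k::comm_ring_1"
  shows "\<exists>\<sigma> :: int \<Rightarrow> 'k. \<sigma> 0 = x \<and> \<sigma> 1 = y \<and> \<sigma> 2 = z \<and>
    (\<forall>n. \<sigma> (n + 3) = N * \<sigma> (n + 2) * \<sigma> (n + 1) - \<sigma> n)"
proof -
  define \<sigma> where "\<sigma> n =
    (if 0 \<le> n then markov_fwd N x y z (nat n) else markov_fwd N z y x (nat (2 - n)))" for n :: int
  have right: "\<sigma> n = markov_fwd N x y z (nat n)" if "0 \<le> n" for n
    using that by (simp add: \<sigma>_def)
  have left: "\<sigma> n = markov_fwd N z y x (nat (2 - n))" if le: "n \<le> 2" for n
  proof -
    consider "n < 0" | "n = 0" | "n = 1" | "n = 2" using le by linarith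
    then show ?thesis by cases (simp_all add: \<sigma>_def numeral_2_eq_2)
  qed
  have "\<sigma> (n + 3) = N * \<sigma> (n + 2) * \<sigma> (n + 1) - \<sigma> n" for n
  proof (cases "0 \<le> n")
    case True
    define m where "m = nat n"
    have "nat (n + 3) = Suc (Suc (Suc m))" "nat (n + 2) = Suc (Suc m)"
      "nat (n + 1) = Suc m" "nat n = m"
      using True by (auto simp: m_def)
    with True show ?thesis by (simp add: right)
  next
    case False
    define m where "m = nat (- 1 - n)"
    have "nat (2 - n) = Suc (Suc (Suc m))" "nat (2 - (n + 1)) = Suc (Suc m)"
      "nat (2 - (n + 2)) = Suc m" "nat (2 - (n + 3)) = m"
      using False by (auto simp: m_def)
    with False show ?thesis by (simp add: left mult_ac)
  qed
  moreover have "\<sigma> 0 = x" "\<sigma> 1 = y" "\<sigma> 2 = z"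
    by (simp_all add: right numeral_2_eq_2)
  ultimately show ?thesis by blast
qed


text \<open>This is the Vieta involution of equations of Markov type: replacing one of the three
  variables by the other root of the quadratic that it satisfies stays on the cubic surface.\<close>

lemma markov_cubic_vanishes:
  fixes \<sigma> :: "int \<Rightarrow> 'k::comm_ring_1"
  assumes rec: "\<And>n. \<sigma> (n + 3) = N * \<sigma> (n + 2) * \<sigma> (n + 1) - \<sigma> n"
    and init: "(\<sigma> 2)\<^sup>2 + (\<sigma> 1)\<^sup>2 + (\<sigma> 0)\<^sup>2 + J = N * \<sigma> 2 * \<sigma> 1 * \<sigma> 0"
  shows "(\<sigma> (n + 2))\<^sup>2 + (\<sigma> (n + 1))\<^sup>2 + (\<sigma> n)\<^sup>2 + J = N * \<sigma> (n + 2) * \<sigma> (n + 1) * \<sigma> n"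
proof -
  define K where "K n = (\<sigma> (n + 2))\<^sup>2 + (\<sigma> (n + 1))\<^sup>2 + (\<sigma> n)\<^sup>2 + J
    - N * \<sigma> (n + 2) * \<sigma> (n + 1) * \<sigma> n" for n
  have step: "K (n + 1) = K n" for n
  proof -
    have "n + 1 + 2 = n + 3" "n + 1 + 1 = n + 2" by simp_all
    then have "K (n + 1) - K n =
        (\<sigma> (n + 3) - \<sigma> n) * (\<sigma> (n + 3) + \<sigma> n - N * \<sigma> (n + 2) * \<sigma> (n + 1))"
      by (simp add: K_def algebra_simps power2_eq_square)
    then show ?thesis by (simp add: rec [of n])
  qed
  have "K n = 0"
  proof (induction n rule: int_induct [where k = 0])
    case base
    show ?case using init by (simp add: K_def)
  next
    case (step1 i)
    then show ?case by (simp add: step)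
  next
    case (step2 i)
    then show ?case using step [of "i - 1"] by simp
  qed
  then show ?thesis by (simp add: K_def)
qed

section \<open>Positivity of the indeterminates\<close>

text \<open>The ordering of \<open>R[X]\<close> is by the sign of the leading coefficient, which makes \<open>X\<close>
  infinitely large; hence each indeterminate is positive in the iterated construction.\<close>

lemma to_fract_pos:
  fixes x :: "'a::linordered_idom"
  assumes "0 < x"
  shows "0 < to_fract x"
  using assms by (simp add: to_fract_def zero_less_Fract_iff)

lemma indeterminates_pos: "0 < ind_a" "0 < ind_b" "0 < ind_c" "0 < ind_J"
  unfolding ind_a_def ind_b_def ind_c_def ind_J_def
  by (rule to_fract_pos, simp add: less_poly_def pos_poly_def)+

lemma quadratic_rec_pos:
  assumes "init_data \<tau>" "quadratic_rec \<tau>"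
  shows "0 < \<tau> n"
proof -
  have prod_pos: "0 < \<tau> (n + 3) * \<tau> n" for n
    using assms(2) indeterminates_pos(4)
    by (simp add: quadratic_rec_def add_nonneg_pos)
  show ?thesis
  proof (induction n rule: int_window_induct)
    case (4 n)
    then show ?case using prod_pos [of n] by (simp add: zero_less_mult_iff)
  next
    case (5 n)
    then show ?case using prod_pos [of n] by (simp add: zero_less_mult_iff)
  qed (use assms(1) indeterminates_pos in \<open>simp_all add: init_data_def\<close>)
qed

lemma quadratic_rec_unique:
  assumes \<sigma>: "init_data \<sigma>" "quadratic_rec \<sigma>"
    and \<tau>: "init_data \<tau>" "quadratic_rec \<tau>"
  shows "\<sigma> = \<tau>"
proof
  fix n
  have nz: "\<tau> n \<noteq> 0" for n
    using quadratic_rec_pos [OF \<tau>, of n] by simp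
  show "\<sigma> n = \<tau> n"
  proof (induction n rule: int_window_induct)
    case (4 n)
    then have "\<sigma> (n + 3) * \<tau> n = \<tau> (n + 3) * \<tau> n"
      using \<sigma>(2) \<tau>(2) by (metis quadratic_rec_def)
    then show ?case using nz [of n] by simp
  next
    case (5 n)
    then have "\<tau> (n + 3) * \<sigma> n = \<tau> (n + 3) * \<tau> n"
      using \<sigma>(2) \<tau>(2) by (metis quadratic_rec_def)
    then show ?case using nz [of "n + 3"] by simp
  qed (use \<sigma>(1) \<tau>(1) in \<open>simp_all add: init_data_def\<close>)
qed

section \<open>From the recurrence with \<open>N\<close> to the quadratic one\<close>

lemma N_rec_cubic:
  assumes "init_data \<sigma>" "N_rec \<sigma>"
  shows "(\<sigma> (n + 2))\<^sup>2 + (\<sigma> (n + 1))\<^sup>2 + (\<sigma> n)\<^sup>2 + ind_J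
    = elt_N * \<sigma> (n + 2) * \<sigma> (n + 1) * \<sigma> n"
proof (rule markov_cubic_vanishes)
  show "\<sigma> (n + 3) = elt_N * \<sigma> (n + 2) * \<sigma> (n + 1) - \<sigma> n" for n
    using assms(2) by (simp add: N_rec_def)
  show "(\<sigma> 2)\<^sup>2 + (\<sigma> 1)\<^sup>2 + (\<sigma> 0)\<^sup>2 + ind_J = elt_N * \<sigma> 2 * \<sigma> 1 * \<sigma> 0"
    using assms(1) indeterminates_pos by (simp add: init_data_def elt_N_def field_simps)
qed

lemma N_rec_imp_quadratic_rec:
  assumes "init_data \<sigma>" "N_rec \<sigma>"
  shows "quadratic_rec \<sigma>"
  unfolding quadratic_rec_def
proof
  fix n
  have "\<sigma> (n + 3) * \<sigma> n = elt_N * \<sigma> (n + 2) * \<sigma> (n + 1) * \<sigma> n - (\<sigma> n)\<^sup>2"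
    using assms(2) by (simp add: N_rec_def power2_eq_square left_diff_distrib)
  also have "\<dots> = (\<sigma> (n + 2))\<^sup>2 + (\<sigma> (n + 1))\<^sup>2 + ind_J"
    by (simp flip: N_rec_cubic [OF assms, of n])
  finally show "\<sigma> (n + 3) * \<sigma> n = (\<sigma> (n + 2))\<^sup>2 + (\<sigma> (n + 1))\<^sup>2 + ind_J" .
qed

section \<open>The generated subrings\<close>

lemma generator_in_Z_adjoin: "x \<in> S \<Longrightarrow> x \<in> Z_adjoin S"
  unfolding Z_adjoin_def by (rule hull_inc)

lemma is_subring_closed:
  assumes "is_subring R" "x \<in> R" "y \<in> R"
  shows "x - y \<in> R" "x * y \<in> R" "x + y \<in> R"
proof -
  show diff: "x - y \<in> R" "x * y \<in> R" using assms by (simp_all add: is_subring_def)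
  have "x - ((x - x) - y) \<in> R" using assms by (metis is_subring_def)
  then show "x + y \<in> R" by simp
qed

lemma ring_abcN_subset_laurent_ring: "ring_abcN \<subseteq> laurent_ring"
proof -
  have subring: "is_subring laurent_ring"
    unfolding laurent_ring_def by (rule is_subring_Z_adjoin)
  note closed = is_subring_closed [OF subring]
  have gens: "ind_a \<in> laurent_ring" "ind_b \<in> laurent_ring" "ind_c \<in> laurent_ring"
    "ind_J \<in> laurent_ring" "inverse ind_a \<in> laurent_ring" "inverse ind_b \<in> laurent_ring"
    "inverse ind_c \<in> laurent_ring"
    unfolding laurent_ring_def by (simp_all add: generator_in_Z_adjoin)
  have "elt_N = (ind_a * ind_a + ind_b * ind_b + ind_c * ind_c + ind_J)
      * (inverse ind_a * inverse ind_b * inverse ind_c)"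
    by (simp add: elt_N_def divide_inverse power2_eq_square)
  also have "\<dots> \<in> laurent_ring" by (intro closed gens)
  finally have "elt_N \<in> laurent_ring" .
  then show ?thesis
    unfolding ring_abcN_def Z_adjoin_def using gens subring by (intro hull_minimal) auto
qed

lemma N_rec_in_ring_abcN:
  assumes "init_data \<sigma>" "N_rec \<sigma>"
  shows "\<sigma> n \<in> ring_abcN"
proof -
  have "is_subring ring_abcN"
    unfolding ring_abcN_def by (rule is_subring_Z_adjoin)
  note closed = is_subring_closed [OF this]
  have gens: "ind_a \<in> ring_abcN" "ind_b \<in> ring_abcN" "ind_c \<in> ring_abcN" "elt_N \<in> ring_abcN"
    unfolding ring_abcN_def by (simp_all add: generator_in_Z_adjoin)
  have rec: "\<sigma> (n + 3) = elt_N * \<sigma> (n + 2) * \<sigma> (n + 1) - \<sigma> n" for n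
    using assms(2) by (simp add: N_rec_def)
  show ?thesis
  proof (induction n rule: int_window_induct)
    case (4 n)
    then show ?case unfolding rec by (intro closed gens)
  next
    case (5 n)
    have "\<sigma> n = elt_N * \<sigma> (n + 2) * \<sigma> (n + 1) - \<sigma> (n + 3)" by (simp add: rec)
    also have "\<dots> \<in> ring_abcN" using 5 by (intro closed gens)
    finally show ?case .
  qed (use assms(1) gens in \<open>simp_all add: init_data_def\<close>)
qed

section \<open>The invariant, the two recurrences and the Laurent property\<close>

theorem proposition1:
  shows "(\<exists>!\<tau>. init_data \<tau> \<and> quadratic_rec \<tau>) \<and>
    (\<forall>\<tau>. init_data \<tau> \<and> quadratic_rec \<tau> \<longrightarrow>
      (\<forall>n. \<tau> n \<noteq> 0) \<and>
      (\<forall>n. inv_quot \<tau> n = inv_quot \<tau> 0) \<and> inv_quot \<tau> 0 = elt_N \<and>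
      (\<forall>\<sigma>. init_data \<sigma> \<and> N_rec \<sigma> \<longleftrightarrow> \<sigma> = \<tau>) \<and>
      (\<forall>n. \<tau> n \<in> ring_abcN)) \<and>
    ring_abcN \<subseteq> laurent_ring"
proof -
  obtain \<rho> where \<rho>: "init_data \<rho>" "N_rec \<rho>"
    using markov_sequence_exists [of ind_a ind_b ind_c elt_N]
    by (auto simp: init_data_def N_rec_def)
  note quad = N_rec_imp_quadratic_rec [OF \<rho>]
  have nz: "\<rho> n \<noteq> 0" for n
    using quadratic_rec_pos [OF \<rho>(1) quad, of n] by simp
  have inv: "inv_quot \<rho> n = elt_N" for n
    unfolding inv_quot_def N_rec_cubic [OF \<rho>] using nz by simp
  have N_iff: "init_data \<sigma> \<and> N_rec \<sigma> \<longleftrightarrow> \<sigma> = \<rho>" for \<sigma>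
    using \<rho> N_rec_imp_quadratic_rec quadratic_rec_unique [OF _ _ \<rho>(1) quad] by blast
  have quad_iff: "init_data \<tau> \<and> quadratic_rec \<tau> \<longleftrightarrow> \<tau> = \<rho>" for \<tau>
    using \<rho>(1) quad quadratic_rec_unique by blast
  show ?thesis
    unfolding quad_iff
    using nz inv N_iff N_rec_in_ring_abcN [OF \<rho>] ring_abcN_subset_laurent_ring by simp
qed

end
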